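(* For every integer $n\ge 2$, let $G(n)$ be the finite simple graph whose vertices are the square-free integers $k$ with $2\le k\le n$, two distinct vertices $a,b$ being joined by an edge if and only if $a$ divides $b$ or $b$ divides $a$. Then the Euler characteristic of $G(n)$ satisfies $$\chi(G(n)) = 1 - M(n),$$ where $M(n)=\sum_{k=1}^n \mu(k)$ is the Mertens function and $\mu$ is the Möbius function.
   Context: For a finite simple graph $G$, a $k$-simplex of $G$ is a complete subgraph with $k+1$ vertices ($k\ge 0$), $v_k(G)$ is the number of $k$-simplices of $G$, and the Euler characteristic is $\chi(G)=\sum_{k\ge 0}(-1)^k v_k(G)$. The Möbius function is $\mu(1)=1$, $\mu(x)=(-1)^r$ if $x$ is a product of $r$ distinct primes, and $\mu(x)=0$ if $x$ is divisible by the square of a prime. *)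

theory Defs
  imports
    "Graph_Theory.Graph_Theory"
    "HOL-Computational_Algebra.Primes"
    "HOL-Computational_Algebra.Squarefree"
begin

section \<open>Simplices and the Euler characteristic of a finite simple graph\<close>

text \<open>
  As in the Graph Theory library, a finite simple graph is a finite, loop-free, symmetric
  digraph without parallel arcs (locale \<^locale>\<open>graph\<close>): an undirected edge is the pair of
  its two orientations.  A complete graph in the sense of \<^const>\<open>complete_digraph\<close> contains both
  orientations of each of its edges, so the complete subgraphs of such a graph correspond one to
  one to those of the undirected graph.
\<close>

definition simplices :: "nat \<Rightarrow> ('a, 'b) pre_digraph \<Rightarrow> ('a, 'b) pre_digraph set" where
  "simplices k G = {H. subgraph H G \<and> complete_digraph (k + 1) H}"

definition num_simplices :: "nat \<Rightarrow> ('a, 'b) pre_digraph \<Rightarrow> nat" where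
  "num_simplices k G = card (simplices k G)"

text \<open>
  The sum over all \<open>k \<ge> 0\<close> has only finitely many nonzero terms; it is cut off at the number of
  vertices, which is harmless by lemma \<open>num_simplices_eq_0\<close> below.
\<close>

definition euler_char :: "('a, 'b) pre_digraph \<Rightarrow> int" where
  "euler_char G = (\<Sum>k < card (verts G). (-1) ^ k * int (num_simplices k G))"

lemma num_simplices_eq_0:
  assumes "graph G" and "card (verts G) \<le> k"
  shows "num_simplices k G = 0"
proof -
  interpret graph G by fact
  have "H \<notin> simplices k G" for H
  proof
    assume "H \<in> simplices k G"
    then have "verts H \<subseteq> verts G" and "card (verts H) = k + 1"
      by (auto simp: simplices_def subgraph_def complete_digraph_def)
    then have "k + 1 \<le> card (verts G)"
      using card_mono[OF finite_verts] by metis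
    with assms(2) show False by simp
  qed
  then have "simplices k G = {}" by blast
  then show ?thesis by (simp add: num_simplices_def)
qed


section \<open>The graph of square-free integers\<close>

definition sqfree_graph :: "nat \<Rightarrow> nat pair_pre_digraph" where
  "sqfree_graph n =
    (let V = {k. 2 \<le> k \<and> k \<le> n \<and> squarefree k}
     in \<lparr> pverts = V,
          parcs = {(a, b). a \<in> V \<and> b \<in> V \<and> a \<noteq> b \<and> (a dvd b \<or> b dvd a)} \<rparr>)"

lemma pair_graph_sqfree_graph: "pair_graph (sqfree_graph n)"
proof -
  let ?V = "{k. 2 \<le> k \<and> k \<le> n \<and> squarefree k}"
  have V: "finite ?V" by simp
  have "parcs (sqfree_graph n) \<subseteq> ?V \<times> ?V"
    by (auto simp: sqfree_graph_def Let_def)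
  then have "finite (parcs (sqfree_graph n))"
    using V by (meson finite_SigmaI finite_subset)
  then show ?thesis
    by unfold_locales (auto simp: sqfree_graph_def Let_def symmetric_def intro: symI)
qed

lemma graph_sqfree_graph: "graph (with_proj (sqfree_graph n))"
proof -
  interpret pair_graph "sqfree_graph n" by (rule pair_graph_sqfree_graph)
  show ?thesis by unfold_locales
qed


section \<open>The Moebius and Mertens functions\<close>

definition moebius :: "nat \<Rightarrow> int" where
  "moebius n = (if \<exists>p. prime p \<and> p\<^sup>2 dvd n then 0 else (-1) ^ card (prime_factors n))"

lemma moebius_1: "moebius 1 = 1"
  by (auto simp: moebius_def power2_eq_square)

lemma moebius_prod_primes:
  assumes "finite P" and "\<And>p. p \<in> P \<Longrightarrow> prime p"
  shows "moebius (\<Prod>P) = (-1) ^ card P"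
proof -
  have fac: "prime_factorization (\<Prod>P) = mset_set P"
    using assms
  proof (induction P rule: finite_induct)
    case (insert x F)
    have "0 \<notin> F" and "prime x" using insert.prems not_prime_0 by blast+
    then have "\<Prod>F \<noteq> 0" and "x \<noteq> 0"
      using insert.hyps by (auto simp: prod_zero_iff)
    moreover have "prime_factorization (\<Prod>F) = mset_set F"
      using insert.IH insert.prems by blast
    ultimately show ?case
      using insert.hyps \<open>prime x\<close>
      by (simp add: prime_factorization_mult prime_factorization_prime)
  qed simp
  have nz: "\<Prod>P \<noteq> 0"
    using assms not_prime_0 by (metis prod_zero_iff)
  have "\<not> p\<^sup>2 dvd \<Prod>P" if "prime p" for p
  proof
    assume "p\<^sup>2 dvd \<Prod>P"
    then have "2 \<le> multiplicity p (\<Prod>P)"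
      using nz that by (intro multiplicity_geI) auto
    also have "\<dots> = count (mset_set P) p"
      using that fac count_prime_factorization_prime[of p "\<Prod>P"] by simp
    also have "\<dots> \<le> 1"
      by (cases "p \<in> P") (use assms(1) in auto)
    finally show False by simp
  qed
  then show ?thesis
    using assms(1) fac by (auto simp: moebius_def)
qed

definition mertens :: "nat \<Rightarrow> int" where
  "mertens n = (\<Sum>k = 1..n. moebius k)"

end

theory Submission
  imports Defs
begin

text \<open>
  A simplex of a graph is determined by its vertex set, so the Euler characteristic is a signed
  count of nonempty cliques, and the cliques of the divisibility graph are the chains of the
  divisibility order. Write \<open>s V\<close> for the sum of \<open>(-1) ^ card C\<close> over all chains \<open>C\<close> of \<open>V\<close>, the
  empty one included; the Euler characteristic of the divisibility graph on \<open>V\<close> is \<open>1 - s V\<close>.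

  Sorting the nonempty chains by their top element \<open>x\<close>, whose removal leaves an arbitrary chain of
  proper divisors of \<open>x\<close>, gives \<open>s V = 1 - (\<Sum>x\<in>V. s (V\<^sub>x))\<close>, where \<open>V\<^sub>x\<close> consists of the proper
  divisors of \<open>x\<close> in \<open>V\<close> (lemma \<open>chain_sum_by_top\<close>). If \<open>x\<close> is square-free and \<open>V\<^sub>x\<close> consists of
  all its proper divisors other than 1, this recursion is the one by which the Moebius function is
  determined from \<open>(\<Sum>d | d dvd x. \<mu> d) = 0\<close>, so that \<open>s (V\<^sub>x) = - \<mu> x\<close> (lemma
  \<open>chain_sum_proper_divisors\<close>). Hence adding a vertex \<open>x\<close> on top changes the Euler characteristic
  by \<open>- \<mu> x\<close>, and for the square-free numbers in \<open>{2..n}\<close> the total is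
  \<open>1 - s V = - (\<Sum>x\<in>V. \<mu> x) = 1 - M(n)\<close>, the 1 being \<open>\<mu> 1\<close>, which \<open>M(n)\<close> counts although 1 is not
  a vertex.
\<close>


section \<open>Simplices as cliques\<close>

definition cliques :: "('a, 'b) pre_digraph \<Rightarrow> 'a set set" where
  "cliques G = {S. S \<subseteq> verts G \<and> (\<forall>u\<in>S. \<forall>v\<in>S. u \<noteq> v \<longrightarrow> (u, v) \<in> arcs_ends G)}"

text \<open>
  In the absence of parallel arcs, completeness forces a simplex to contain every arc of the graph
  between its vertices; this makes its vertex set determine it.
\<close>

lemma (in graph) simplex_eq_induce_subgraph:
  assumes "H \<in> simplices k G"
  shows "H = G \<restriction> verts H"
proof -
  from assms have sub: "arcs H \<subseteq> arcs G" and ends: "tail H = tail G" "head H = head G"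
    and "wf_digraph H" and "graph H"
    and complete: "arcs_ends H = {(u, v). (u, v) \<in> verts H \<times> verts H \<and> u \<noteq> v}"
    by (auto simp: simplices_def subgraph_def compatible_def complete_digraph_def)
  interpret H: wf_digraph H by fact
  have "e \<in> arcs H"
    if e: "e \<in> arcs G" and in_H: "tail G e \<in> verts H" "head G e \<in> verts H" for e
  proof -
    have "(tail G e, head G e) \<in> arcs_ends H"
      unfolding complete using in_H no_loops[OF e] by auto
    then obtain e' where "e' \<in> arcs H" and "tail G e' = tail G e" "head G e' = head G e"
      by (auto simp: arcs_ends_conv ends)
    then have "e = e'"
      using sub e by (intro no_multi_arcs) (auto simp: arc_to_ends_def)
    with \<open>e' \<in> arcs H\<close> show ?thesis by simp
  qed
  then have "arcs H = {e \<in> arcs G. tail G e \<in> verts H \<and> head G e \<in> verts H}"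
    using sub H.tail_in_verts H.head_in_verts by (auto simp: ends)
  then show ?thesis
    using ends by (intro pre_digraph.equality) auto
qed

lemma (in graph) induce_subgraph_clique:
  assumes "S \<in> cliques G" and "card S = k + 1"
  shows "G \<restriction> S \<in> simplices k G"
proof -
  from assms(1) have S: "S \<subseteq> verts G" by (simp add: cliques_def)
  then have ind: "induced_subgraph (G \<restriction> S) G" by (rule induced_induce)
  then interpret D: digraph "G \<restriction> S" by (rule digraphI_induced)
  interpret Sym: sym_digraph "G \<restriction> S" using ind by (rule induced_graph_imp_graph)
  have "graph (G \<restriction> S)" by unfold_locales
  moreover have "arcs_ends (G \<restriction> S) = {(u, v). (u, v) \<in> S \<times> S \<and> u \<noteq> v}"
  proof (intro subset_antisym subrelI)
    fix u v assume "(u, v) \<in> arcs_ends (G \<restriction> S)"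
    then show "(u, v) \<in> {(u, v). (u, v) \<in> S \<times> S \<and> u \<noteq> v}"
      using no_loops by (auto simp: arcs_ends_conv)
  next
    fix u v assume "(u, v) \<in> {(u, v). (u, v) \<in> S \<times> S \<and> u \<noteq> v}"
    then have "u \<in> S" "v \<in> S" and "(u, v) \<in> arcs_ends G"
      using assms(1) by (auto simp: cliques_def)
    then show "(u, v) \<in> arcs_ends (G \<restriction> S)"
      by (auto simp: arcs_ends_conv)
  qed
  ultimately show ?thesis
    using ind assms(2) by (auto simp: simplices_def complete_digraph_def induced_subgraph_def)
qed

lemma (in graph) num_simplices_eq_card_cliques:
  "num_simplices k G = card {S \<in> cliques G. card S = k + 1}"
proof -
  have "bij_betw verts (simplices k G) {S \<in> cliques G. card S = k + 1}"
  proof (rule bij_betw_byWitness[where f' = "\<lambda>S. G \<restriction> S"])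
    show "\<forall>H \<in> simplices k G. G \<restriction> verts H = H"
      using simplex_eq_induce_subgraph by metis
    show "verts ` simplices k G \<subseteq> {S \<in> cliques G. card S = k + 1}"
    proof safe
      fix H assume H: "H \<in> simplices k G"
      then have "arcs_ends H \<subseteq> arcs_ends G"
        by (auto simp: simplices_def subgraph_def compatible_def arcs_ends_conv)
      then show "verts H \<in> cliques G"
        using H by (auto simp: simplices_def cliques_def subgraph_def complete_digraph_def)
      show "card (verts H) = k + 1"
        using H by (simp add: simplices_def complete_digraph_def)
    qed
    show "(\<lambda>S. G \<restriction> S) ` {S \<in> cliques G. card S = k + 1} \<subseteq> simplices k G"
      using induce_subgraph_clique by blast
  qed simp
  then show ?thesis
    by (simp add: num_simplices_def bij_betw_same_card)
qed

text \<open>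
  The 1 is the term of the empty clique, which is not a simplex. It is kept in the sum because
  deleting a vertex from all cliques that contain it should again give a set of cliques.
\<close>

lemma (in graph) euler_char_eq_clique_sum:
  "euler_char G = 1 - (\<Sum>S\<in>cliques G. (-1) ^ card S)"
proof -
  let ?N = "card (verts G)"
  let ?C = "\<lambda>k. {S \<in> cliques G. card S = k + 1}"
  have sub: "cliques G \<subseteq> Pow (verts G)"
    by (auto simp: cliques_def)
  then have fin: "finite (cliques G)"
    by (rule finite_subset) simp
  have "cliques G - {{}} = (\<Union>k<?N. ?C k)"
  proof (intro subset_antisym subsetI)
    fix S assume S: "S \<in> cliques G - {{}}"
    then have "S \<subseteq> verts G" using sub by auto
    then have "finite S" and "card S \<le> ?N"
      by (auto intro: finite_subset card_mono)
    moreover have "S \<noteq> {}" using S by simp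
    ultimately have "card S = (card S - 1) + 1" and "card S - 1 < ?N"
      using card_gt_0_iff[of S] by linarith+
    then show "S \<in> (\<Union>k<?N. ?C k)" using S by blast
  qed auto
  then have "(\<Sum>S\<in>cliques G - {{}}. (-1) ^ card S) = (\<Sum>S\<in>(\<Union>k<?N. ?C k). (-1 :: int) ^ card S)"
    by simp
  also have "\<dots> = (\<Sum>k<?N. \<Sum>S\<in>?C k. (-1) ^ card S)"
    by (rule sum.UNION_disjoint) (use fin in auto)
  also have "\<dots> = - euler_char G"
    by (simp add: euler_char_def num_simplices_eq_card_cliques sum_negf [symmetric] mult.commute)
  finally have "(\<Sum>S\<in>cliques G - {{}}. (-1) ^ card S) = - euler_char G" .
  moreover have "{} \<in> cliques G" by (simp add: cliques_def)
  ultimately show ?thesis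
    using sum.remove[OF fin, of "{}" "\<lambda>S. (-1 :: int) ^ card S"] by simp
qed


section \<open>Signed sums over chains of the divisibility order\<close>

definition dvd_chains :: "nat set \<Rightarrow> nat set set" where
  "dvd_chains V = {C. C \<subseteq> V \<and> (\<forall>a\<in>C. \<forall>b\<in>C. a dvd b \<or> b dvd a)}"

definition chain_sum :: "nat set \<Rightarrow> int" where
  "chain_sum V = (\<Sum>C\<in>dvd_chains V. (-1) ^ card C)"

lemma finite_dvd_chains: "finite V \<Longrightarrow> finite (dvd_chains V)"
  by (rule finite_subset[of _ "Pow V"]) (auto simp: dvd_chains_def)

lemma chain_sum_empty: "chain_sum {} = 1"
proof -
  have "dvd_chains {} = {{}}" by (auto simp: dvd_chains_def)
  then show ?thesis by (simp add: chain_sum_def)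
qed

text \<open>
  The chains through a maximal element \<open>x\<close> arise by adding \<open>x\<close>, at the cost of a sign, to the
  chains of elements below \<open>x\<close>.
\<close>

lemma chain_sum_insert:
  assumes "finite V" and "x \<notin> V" and max: "\<And>v. v \<in> V \<Longrightarrow> \<not> x dvd v"
  shows "chain_sum (insert x V) = chain_sum V - chain_sum {d \<in> V. d dvd x}"
proof -
  let ?B = "dvd_chains {d \<in> V. d dvd x}"
  have eq: "dvd_chains (insert x V) = dvd_chains V \<union> insert x ` ?B"
  proof (intro subset_antisym subsetI)
    fix C assume C: "C \<in> dvd_chains (insert x V)"
    show "C \<in> dvd_chains V \<union> insert x ` ?B"
    proof (cases "x \<in> C")
      case True
      have "C - {x} \<in> ?B"
        using C True max by (auto simp: dvd_chains_def)
      moreover have "C = insert x (C - {x})"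
        using True by blast
      ultimately show ?thesis by blast
    next
      case False
      then show ?thesis using C by (auto simp: dvd_chains_def)
    qed
  qed (auto simp: dvd_chains_def)
  have fin: "finite (dvd_chains V)" "finite ?B"
    using assms(1) by (auto intro: finite_dvd_chains)
  have not_in: "x \<notin> C" and finC: "finite C" if "C \<in> ?B" for C
    using that assms(1,2) by (auto simp: dvd_chains_def intro: finite_subset)
  have inj: "inj_on (insert x) ?B"
    by (rule inj_onI) (metis not_in insert_ident)
  have "chain_sum (insert x V) = chain_sum V + (\<Sum>C\<in>insert x ` ?B. (-1) ^ card C)"
    unfolding chain_sum_def eq
    by (rule sum.union_disjoint) (use fin assms(2) in \<open>auto simp: dvd_chains_def\<close>)
  also have "(\<Sum>C\<in>insert x ` ?B. (-1) ^ card C) = (\<Sum>C\<in>?B. - ((-1 :: int) ^ card C))"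
    unfolding sum.reindex[OF inj] by (rule sum.cong) (use not_in finC in auto)
  also have "\<dots> = - chain_sum {d \<in> V. d dvd x}"
    by (simp add: chain_sum_def sum_negf)
  finally show ?thesis by simp
qed

lemma chain_sum_by_top:
  assumes "finite V" and "0 \<notin> V"
  shows "chain_sum V = 1 - (\<Sum>x\<in>V. chain_sum {d \<in> V. d dvd x \<and> d \<noteq> x})"
  using assms
proof (induction V rule: finite_linorder_max_induct)
  case empty
  show ?case by (simp add: chain_sum_empty)
next
  case (insert b V)
  have not_dvd: "\<not> b dvd v" if "v \<in> V" for v
    using that insert.hyps(2) insert.prems by (metis dvd_imp_le insertCI leD neq0_conv)
  have "b \<notin> V" using insert.hyps(2) by blast
  have below: "{d \<in> insert b V. d dvd x \<and> d \<noteq> x} = {d \<in> V. d dvd x \<and> d \<noteq> x}" if "x \<in> V" for x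
    using not_dvd[OF that] by auto
  have below_b: "{d \<in> insert b V. d dvd b \<and> d \<noteq> b} = {d \<in> V. d dvd b}"
    using \<open>b \<notin> V\<close> by auto
  have "chain_sum (insert b V) = chain_sum V - chain_sum {d \<in> V. d dvd b}"
    using insert.hyps(1) \<open>b \<notin> V\<close> not_dvd by (rule chain_sum_insert)
  moreover have "chain_sum V = 1 - (\<Sum>x\<in>V. chain_sum {d \<in> V. d dvd x \<and> d \<noteq> x})"
    using insert.IH insert.prems by blast
  moreover have "(\<Sum>x\<in>insert b V. chain_sum {d \<in> insert b V. d dvd x \<and> d \<noteq> x})
      = chain_sum {d \<in> V. d dvd b} + (\<Sum>x\<in>V. chain_sum {d \<in> V. d dvd x \<and> d \<noteq> x})"
    unfolding sum.insert[OF insert.hyps(1) \<open>b \<notin> V\<close>] below_b using below by simp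
  ultimately show ?case by simp
qed


section \<open>The Moebius function on square-free numbers\<close>

lemma moebius_eq_if_squarefree:
  "moebius n = (if squarefree n then (-1) ^ card (prime_factors n) else 0)"
proof (cases "n = 0")
  case True
  have "\<exists>p :: nat. prime p" using two_is_prime_nat by blast
  with True show ?thesis by (simp add: moebius_def)
next
  case False
  then show ?thesis
    by (simp add: moebius_def squarefree_factorial_semiring)
qed

lemma moebius_prime_mult:
  assumes "prime p" and "\<not> p dvd d" and "squarefree d"
  shows "moebius (p * d) = - moebius d"
proof -
  have "d \<noteq> 0" using assms(2) by (metis dvd_0_right)
  have "coprime p d" using assms(1,2) by (simp add: prime_imp_coprime)
  then have "squarefree (p * d)"
    using assms(1,3) by (intro squarefree_mult_coprime) (auto intro: squarefree_prime)
  moreover have "prime_factors (p * d) = insert p (prime_factors d)"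
    using assms(1) \<open>d \<noteq> 0\<close> by (auto simp: prime_factors_product prime_factorization_prime)
  moreover have "p \<notin> prime_factors d" using assms(2) by auto
  ultimately show ?thesis
    using assms(3) by (simp add: moebius_eq_if_squarefree)
qed

text \<open>
  For a prime factor \<open>p\<close> of \<open>x\<close>, the divisors of \<open>x\<close> are paired off as \<open>d\<close> and \<open>p * d\<close> with \<open>d\<close> not
  divisible by \<open>p\<close>, and the two values in a pair cancel.
\<close>

lemma sum_moebius_divisors:
  assumes "squarefree x" and "x > 1"
  shows "(\<Sum>d | d dvd x. moebius d) = 0"
proof -
  obtain p where p: "prime p" "p dvd x"
    using assms(2) prime_factor_nat[of x] by auto
  then obtain m where x: "x = p * m" by blast
  have "squarefree m" using assms(1) squarefree_multD x by blast
  have "m > 0" using assms(2) x by (cases m) auto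
  have "\<not> p dvd m"
  proof
    assume "p dvd m"
    then have "p\<^sup>2 dvd x" by (simp add: x power2_eq_square)
    with assms(1) have "p dvd 1" by (rule squarefreeD)
    with p(1) show False by (simp add: not_prime_unit)
  qed
  let ?D = "{d. d dvd m}"
  have not_dvd: "\<not> p dvd d" if "d \<in> ?D" for d
    using that \<open>\<not> p dvd m\<close> dvd_trans by blast
  have "{d. d dvd x} = ?D \<union> (*) p ` ?D"
  proof (intro subset_antisym subsetI)
    fix d assume "d \<in> {d. d dvd x}"
    then have d: "d dvd p * m" by (simp add: x)
    show "d \<in> ?D \<union> (*) p ` ?D"
    proof (cases "p dvd d")
      case True
      then obtain e where "d = p * e" by blast
      then show ?thesis using d p(1) by auto
    next
      case False
      then have "coprime d p"
        using p(1) prime_imp_coprime coprime_commute by metis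
      then show ?thesis using d by (simp add: coprime_dvd_mult_right_iff)
    qed
  qed (auto simp: x)
  then have "(\<Sum>d | d dvd x. moebius d) = (\<Sum>d\<in>?D \<union> (*) p ` ?D. moebius d)"
    by simp
  also have "\<dots> = (\<Sum>d\<in>?D. moebius d) + (\<Sum>d\<in>(*) p ` ?D. moebius d)"
    by (rule sum.union_disjoint) (use \<open>m > 0\<close> not_dvd in auto)
  also have "(\<Sum>d\<in>(*) p ` ?D. moebius d) = (\<Sum>d\<in>?D. moebius (p * d))"
    using p(1) by (subst sum.reindex) (auto simp: inj_on_def prime_gt_0_nat)
  also have "\<dots> = (\<Sum>d\<in>?D. - moebius d)"
    using not_dvd p(1) \<open>squarefree m\<close>
    by (intro sum.cong refl moebius_prime_mult) (auto intro: squarefree_mono)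
  finally show ?thesis by (simp add: sum_negf)
qed

text \<open>
  The negated chain sums of the intervals below the divisors \<open>d > 1\<close> of \<open>x\<close>, together with the
  value 1 at \<open>d = 1\<close>, sum to 0 by \<open>chain_sum_by_top\<close>, and so do the values of the Moebius function.
\<close>

lemma chain_sum_proper_divisors:
  assumes "squarefree x" and "x > 1"
  shows "chain_sum {d. d dvd x \<and> 1 < d \<and> d \<noteq> x} = - moebius x"
  using assms
proof (induction x rule: less_induct)
  case (less x)
  let ?W = "{d. d dvd x \<and> 1 < d \<and> d \<noteq> x}"
  have fin: "finite ?W"
    using less.prems by (intro finite_subset[OF _ finite_divisors_nat[of x]]) auto
  have below: "{e \<in> ?W. e dvd d \<and> e \<noteq> d} = {e. e dvd d \<and> 1 < e \<and> e \<noteq> d}" if "d \<in> ?W" for d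
    using that by (auto intro: dvd_trans dest: dvd_antisym)
  have IH: "chain_sum {e. e dvd d \<and> 1 < e \<and> e \<noteq> d} = - moebius d" if "d \<in> ?W" for d
  proof (rule less.IH)
    show "d < x" using that less.prems dvd_imp_le[of d x] by auto
    show "squarefree d" using that less.prems squarefree_mono by blast
    show "d > 1" using that by simp
  qed
  have "chain_sum ?W = 1 - (\<Sum>d\<in>?W. chain_sum {e \<in> ?W. e dvd d \<and> e \<noteq> d})"
    using fin by (rule chain_sum_by_top) simp
  also have "(\<Sum>d\<in>?W. chain_sum {e \<in> ?W. e dvd d \<and> e \<noteq> d}) = - (\<Sum>d\<in>?W. moebius d)"
    unfolding sum_negf[symmetric] by (rule sum.cong) (use below IH in auto)
  also have "(\<Sum>d\<in>?W. moebius d) = -1 - moebius x"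
  proof -
    have "d > 0" if "d dvd x" for d
      using that less.prems(2) by (intro Nat.gr0I) auto
    then have "{d. d dvd x} = insert 1 (insert x ?W)"
      using less.prems(2) by fastforce
    then have "(\<Sum>d | d dvd x. moebius d) = moebius 1 + (moebius x + (\<Sum>d\<in>?W. moebius d))"
      using fin less.prems(2) by simp
    then show ?thesis
      using sum_moebius_divisors[OF less.prems] by (simp add: moebius_1[simplified])
  qed
  finally show ?case by simp
qed


section \<open>The graph of square-free integers\<close>

lemma cliques_sqfree_graph:
  "cliques (with_proj (sqfree_graph n)) = dvd_chains {k. 2 \<le> k \<and> k \<le> n \<and> squarefree k}"
  (is "_ = dvd_chains ?V")
proof -
  have "((u, v) \<in> parcs (sqfree_graph n)) = (u dvd v \<or> v dvd u)"
    if "u \<in> ?V" "v \<in> ?V" "u \<noteq> v" for u v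
    using that by (simp add: sqfree_graph_def Let_def)
  moreover have "pverts (sqfree_graph n) = ?V"
    by (simp add: sqfree_graph_def Let_def)
  ultimately show ?thesis
    unfolding cliques_def dvd_chains_def with_proj_simps
    by (intro Collect_cong conj_cong) (simp, metis dvd_refl subsetD)
qed

lemma chain_sum_sqfree_vertices:
  assumes "n \<ge> 1"
  shows "chain_sum {k. 2 \<le> k \<and> k \<le> n \<and> squarefree k} = mertens n"
proof -
  let ?V = "{k. 2 \<le> k \<and> k \<le> n \<and> squarefree k}"
  have "{d \<in> ?V. d dvd x \<and> d \<noteq> x} = {d. d dvd x \<and> 1 < d \<and> d \<noteq> x}" if "x \<in> ?V" for x
    using that by (auto dest: dvd_imp_le intro: squarefree_mono)
  then have top: "chain_sum {d \<in> ?V. d dvd x \<and> d \<noteq> x} = - moebius x" if "x \<in> ?V" for x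
    using that chain_sum_proper_divisors by simp
  have "chain_sum ?V = 1 - (\<Sum>x\<in>?V. chain_sum {d \<in> ?V. d dvd x \<and> d \<noteq> x})"
    by (rule chain_sum_by_top) auto
  also have "\<dots> = 1 + (\<Sum>x\<in>?V. moebius x)"
    using top by (simp add: sum_negf)
  also have "(\<Sum>x\<in>?V. moebius x) = (\<Sum>x=2..n. moebius x)"
    by (rule sum.mono_neutral_left) (auto simp: moebius_eq_if_squarefree)
  also have "1 + \<dots> = mertens n"
    using assms by (simp add: mertens_def sum.atLeast_Suc_atMost moebius_1[simplified]
        numeral_2_eq_2)
  finally show ?thesis .
qed

theorem mainTheorem1:
  fixes n :: nat
  assumes "n \<ge> 2"
  shows "euler_char (with_proj (sqfree_graph n)) = 1 - mertens n"
proof -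
  interpret graph "with_proj (sqfree_graph n)" by (rule graph_sqfree_graph)
  have "euler_char (with_proj (sqfree_graph n))
      = 1 - chain_sum {k. 2 \<le> k \<and> k \<le> n \<and> squarefree k}"
    by (simp add: euler_char_eq_clique_sum cliques_sqfree_graph chain_sum_def)
  then show ?thesis
    using assms chain_sum_sqfree_vertices by simp
qed

end
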